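(* Let $\mathbf e$ be a c.e. Turing degree, let $\mathbf f$ be a Turing degree, and let $F\in\mathbf f$ be an $\mathbf e$-c.e. set such that there is a $\Delta^0_2$-approximation $F(x)=\lim_s F_s(x)$, $F_s(x)\in\{0,1\}$, with the property that $$F_s(x)\ne F_{s+1}(x)\implies F_s(y)=F_t(y)$$ for all $x<y<s<t$. Then there is a pair of c.e. sets $U\subseteq V$ such that for every Turing degree $\mathbf x$: there exists an $\mathbf x$-computable set $X$ with $U\subseteq X\subseteq V$ if and only if $\mathbf e\cup\mathbf f\le\mathbf x$.
   Context: All sets are subsets of $\omega$, identified with their characteristic functions. A c.e. degree is a Turing degree containing a c.e. set. A set is $\mathbf e$-c.e. if it is computably enumerable relative to (a set in) the degree $\mathbf e$. A $\Delta^0_2$-approximation $F(x)=\lim_s F_s(x)$ means that $(x,s)\mapsto F_s(x)$ is a computable $\{0,1\}$-valued function and for each $x$ the limit $\lim_s F_s(x)$ exists and equals $F(x)$. The symbol $\cup$ between Turing degrees denotes their join (least upper bound). *)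

theory Defs
  imports Complex_Main
begin

section \<open>Oracle computability\<close>

definition charf :: "nat set \<Rightarrow> nat \<Rightarrow> nat" where
  "charf A x = (if x \<in> A then 1 else 0)"

text \<open>
  Kleene's schemes for the partial recursive functions, extended by the characteristic function of
  an oracle set. Programs carry no arity: a program denotes a partial function of every arity,
  surplus arguments are ignored by the basic functions, and missing arguments lead to divergence.
  On programs used at their intended arity this is the usual semantics, and for each fixed arity
  the functions denoted are exactly the partial functions of that arity recursive in the oracle.
\<close>

datatype prog =
    Zero
  | Succ
  | Proj nat
  | Oracle
  | Comp prog "prog list"
  | PrimRec prog prog
  | Mu prog

fun run :: "nat set \<Rightarrow> prog \<Rightarrow> nat list \<Rightarrow> nat option" where
  "run A Zero xs = Some 0"
| "run A Succ xs = (case xs of [] \<Rightarrow> None | x # _ \<Rightarrow> Some (Suc x))"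
| "run A (Proj i) xs = (if i < length xs then Some (xs ! i) else None)"
| "run A Oracle xs = (case xs of [] \<Rightarrow> None | x # _ \<Rightarrow> Some (charf A x))"
| "run A (Comp p qs) xs = Option.bind (those (map (\<lambda>q. run A q xs) qs)) (run A p)"
| "run A (PrimRec p q) xs =
     (case xs of
        [] \<Rightarrow> None
      | n # ys \<Rightarrow> rec_nat (run A p ys) (\<lambda>k r. Option.bind r (\<lambda>v. run A q (k # v # ys))) n)"
| "run A (Mu p) xs =
     (let halts_at = (\<lambda>n. run A p (n # xs) = Some 0 \<and>
                          (\<forall>m<n. \<exists>k. run A p (m # xs) = Some (Suc k)))
      in if \<exists>n. halts_at n then Some (LEAST n. halts_at n) else None)"

definition computable_in :: "nat set \<Rightarrow> nat set \<Rightarrow> bool" where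
  "computable_in A X \<longleftrightarrow> (\<exists>p. \<forall>x. run A p [x] = Some (charf X x))"

definition ce_in :: "nat set \<Rightarrow> nat set \<Rightarrow> bool" where
  "ce_in A W \<longleftrightarrow> (\<exists>p. \<forall>x. x \<in> W \<longleftrightarrow> run A p [x] \<noteq> None)"

definition ce :: "nat set \<Rightarrow> bool" where
  "ce W \<longleftrightarrow> ce_in {} W"

definition computable2 :: "(nat \<Rightarrow> nat \<Rightarrow> nat) \<Rightarrow> bool" where
  "computable2 g \<longleftrightarrow> (\<exists>p. \<forall>x y. run {} p [x, y] = Some (g x y))"

text \<open>Here and below \<open>Fs s x\<close> is the value at \<open>x\<close> of the \<open>s\<close>-th approximation.\<close>

definition Delta2_approx :: "(nat \<Rightarrow> nat \<Rightarrow> nat) \<Rightarrow> nat set \<Rightarrow> bool" where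
  "Delta2_approx Fs F \<longleftrightarrow>
     computable2 (\<lambda>x s. Fs s x) \<and> (\<forall>x s. Fs s x \<in> {0, 1}) \<and>
     (\<forall>x. (\<lambda>s. Fs s x) \<longlonglongrightarrow> charf F x)"


section \<open>Turing reducibility is a preorder with joins\<close>

lemma computable_in_refl: "computable_in A A"
  unfolding computable_in_def by (rule exI[of _ Oracle]) simp

fun subst_oracle :: "prog \<Rightarrow> prog \<Rightarrow> prog" where
  "subst_oracle r Zero = Zero"
| "subst_oracle r Succ = Succ"
| "subst_oracle r (Proj i) = Proj i"
| "subst_oracle r Oracle = Comp r [Proj 0]"
| "subst_oracle r (Comp p qs) = Comp (subst_oracle r p) (map (subst_oracle r) qs)"
| "subst_oracle r (PrimRec p q) = PrimRec (subst_oracle r p) (subst_oracle r q)"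
| "subst_oracle r (Mu p) = Mu (subst_oracle r p)"

lemma run_subst_oracle:
  assumes r: "\<And>x. run A r [x] = Some (charf B x)"
  shows "run A (subst_oracle r p) xs = run B p xs"
proof (induction p arbitrary: xs)
  case Oracle
  show ?case by (cases xs) (simp_all add: r)
next
  case (Comp p qs)
  have "map (\<lambda>q. run A q xs) (map (subst_oracle r) qs) = map (\<lambda>q. run B q xs) qs"
    using Comp.IH(2) by simp
  moreover have "run A (subst_oracle r p) = run B p"
    using Comp.IH(1) by blast
  ultimately show ?case by (simp only: subst_oracle.simps run.simps)
next
  case (PrimRec p q)
  show ?case by (simp only: subst_oracle.simps run.simps PrimRec.IH)
next
  case (Mu p)
  show ?case by (simp only: subst_oracle.simps run.simps Mu.IH)
qed simp_all

lemma computable_in_trans: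
  assumes "computable_in A B" and "computable_in B C"
  shows "computable_in A C"
proof -
  from assms(1) obtain r where "\<And>x. run A r [x] = Some (charf B x)"
    unfolding computable_in_def by blast
  from run_subst_oracle[OF this] assms(2) show ?thesis
    unfolding computable_in_def by metis
qed

definition set_join :: "nat set \<Rightarrow> nat set \<Rightarrow> nat set" where
  "set_join A B = {2 * n |n. n \<in> A} \<union> {2 * n + 1 |n. n \<in> B}"

lemma charf_set_join_even: "charf (set_join A B) (2 * n) = charf A n"
proof -
  have "2 * n \<in> set_join A B \<longleftrightarrow> n \<in> A"
    unfolding set_join_def by (auto, presburger)
  then show ?thesis by (simp add: charf_def)
qed

lemma charf_set_join_odd: "charf (set_join A B) (Suc (2 * n)) = charf B n"
proof -
  have "Suc (2 * n) \<in> set_join A B \<longleftrightarrow> n \<in> B"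
    unfolding set_join_def by (auto, presburger)
  then show ?thesis by (simp add: charf_def)
qed

definition double_prog :: prog where
  "double_prog = PrimRec Zero (Comp Succ [Comp Succ [Proj 1]])"

lemma run_double: "run A double_prog [n] = Some (2 * n)"
  by (induction n) (simp_all add: double_prog_def)

definition parity_prog :: prog where
  "parity_prog = PrimRec Zero (Comp (PrimRec (Comp Succ [Zero]) Zero) [Proj 1])"

lemma run_parity: "run A parity_prog [n] = Some (n mod 2)"
proof (induction n)
  case 0
  show ?case by (simp add: parity_prog_def)
next
  case (Suc n)
  then show ?case
    by (cases "even n") (simp_all add: parity_prog_def mod_Suc even_iff_mod_2_eq_zero
        odd_iff_mod_2_eq_one)
qed

definition plus_prog :: prog where
  "plus_prog = PrimRec (Proj 0) (Comp Succ [Proj 1])"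

lemma run_plus: "run A plus_prog [m, n] = Some (m + n)"
  by (induction m) (simp_all add: plus_prog_def)

definition half_prog :: prog where
  "half_prog = PrimRec Zero (Comp plus_prog [Comp parity_prog [Proj 0], Proj 1])"

lemma run_half: "run A half_prog [n] = Some (n div 2)"
proof (induction n)
  case 0
  show ?case by (simp add: half_prog_def)
next
  case (Suc n)
  have "n mod 2 + n div 2 = Suc n div 2" by presburger
  with Suc show ?case
    by (simp add: half_prog_def run_parity run_plus)
qed

definition cond_prog :: prog where
  "cond_prog = PrimRec (Proj 0) (Proj 3)"

lemma run_cond: "run A cond_prog [c, a, b] = Some (if c = 0 then a else b)"
  by (induction c) (simp_all add: cond_prog_def)

lemma computable_in_join1: "computable_in (set_join A B) A"
  unfolding computable_in_def
  by (rule exI[of _ "Comp Oracle [double_prog]"]) (simp add: run_double charf_set_join_even)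

lemma computable_in_join2: "computable_in (set_join A B) B"
  unfolding computable_in_def
  by (rule exI[of _ "Comp Oracle [Comp Succ [double_prog]]"])
    (simp add: run_double charf_set_join_odd)

lemma computable_in_join_least:
  assumes "computable_in C A" and "computable_in C B"
  shows "computable_in C (set_join A B)"
proof -
  from assms obtain p q where
    p: "\<And>x. run C p [x] = Some (charf A x)" and q: "\<And>x. run C q [x] = Some (charf B x)"
    unfolding computable_in_def by blast
  have "run C (Comp cond_prog [parity_prog, Comp p [half_prog], Comp q [half_prog]]) [x] =
      Some (charf (set_join A B) x)" for x
  proof (cases "even x")
    case True
    then obtain n where "x = 2 * n" by blast
    then show ?thesis
      by (simp add: run_cond run_parity run_half p q charf_set_join_even)
  next
    case False
    then obtain n where "x = Suc (2 * n)" by (auto elim: oddE)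
    then show ?thesis
      by (simp add: run_cond run_parity run_half p q charf_set_join_odd)
  qed
  then show ?thesis unfolding computable_in_def by blast
qed


section \<open>Turing degrees\<close>

definition turing_equiv :: "nat set \<Rightarrow> nat set \<Rightarrow> bool" where
  "turing_equiv A B \<longleftrightarrow> computable_in A B \<and> computable_in B A"

lemma equivp_turing_equiv: "equivp turing_equiv"
  by (rule equivpI)
    (auto simp: reflp_def symp_def transp_def turing_equiv_def
      intro: computable_in_refl computable_in_trans)

quotient_type tdegree = "nat set" / turing_equiv
  morphisms rep_degree degree_of
  by (rule equivp_turing_equiv)

instantiation tdegree :: semilattice_sup
begin

lift_definition less_eq_tdegree :: "tdegree \<Rightarrow> tdegree \<Rightarrow> bool" is
  "\<lambda>A B. computable_in B A"
  unfolding turing_equiv_def by (blast intro: computable_in_trans)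

definition less_tdegree :: "tdegree \<Rightarrow> tdegree \<Rightarrow> bool" where
  "less_tdegree a b \<longleftrightarrow> a \<le> b \<and> \<not> b \<le> a"

lift_definition sup_tdegree :: "tdegree \<Rightarrow> tdegree \<Rightarrow> tdegree" is set_join
  unfolding turing_equiv_def
  by (blast intro: computable_in_trans computable_in_join1 computable_in_join2
      computable_in_join_least)

instance
proof
  fix a b c :: tdegree
  show "a < b \<longleftrightarrow> a \<le> b \<and> \<not> b \<le> a" by (rule less_tdegree_def)
  show "a \<le> a" by transfer (rule computable_in_refl)
  show "a \<le> b \<Longrightarrow> b \<le> c \<Longrightarrow> a \<le> c" by transfer (rule computable_in_trans)
  show "a \<le> b \<Longrightarrow> b \<le> a \<Longrightarrow> a = b" by transfer (simp add: turing_equiv_def)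
  show "a \<le> sup a b" by transfer (rule computable_in_join1)
  show "b \<le> sup a b" by transfer (rule computable_in_join2)
  show "b \<le> a \<Longrightarrow> c \<le> a \<Longrightarrow> sup b c \<le> a" by transfer (rule computable_in_join_least)
qed

end

definition ce_degree :: "tdegree \<Rightarrow> bool" where
  "ce_degree d \<longleftrightarrow> (\<exists>E. ce E \<and> degree_of E = d)"

definition degree_ce :: "tdegree \<Rightarrow> nat set \<Rightarrow> bool" where
  "degree_ce d W \<longleftrightarrow> (\<exists>A. degree_of A = d \<and> ce_in A W)"

definition degree_computable :: "tdegree \<Rightarrow> nat set \<Rightarrow> bool" where
  "degree_computable d X \<longleftrightarrow> (\<exists>A. degree_of A = d \<and> computable_in A X)"

end

theory Submission
  imports Defs "HOL-Library.Discrete_Functions"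
begin

text \<open>
  Let \<open>E\<close> be a c.e. set of degree \<open>e\<close>. A number \<open>c\<close> stands for the pair of \<open>x = excess c\<close>, which takes
  every value infinitely often, and the stage \<open>c\<close>. The upper set consists of the \<open>c\<close> such that \<open>x\<close> is
  believed to be in \<open>F\<close> at some stage from \<open>c\<close> on; the lower set of the \<open>c\<close> such that \<open>x\<close> has been
  frozen with value \<open>1\<close> by a change at some \<open>z < x\<close>. The set of all \<open>c\<close> with \<open>x \<in> F\<close> lies in between
  and is computable from \<open>F\<close>; a copy of \<open>E\<close> is joined to both ends.

  Let \<open>Y\<close> be in between. Since \<open>F\<close> is c.e. in \<open>E\<close>, its positive facts are found by a search
  from \<open>Y\<close> and \<open>E\<close>. Call \<open>x \<in> F\<close> an error if some code \<open>c\<close> of \<open>x\<close> is missing from \<open>Y\<close>. If there are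
  finitely many errors, then for all other \<open>x\<close> a code of \<open>x\<close> outside \<open>Y\<close> certifies \<open>x \<notin> F\<close>, and there
  is one whenever \<open>x \<notin> F\<close>. If there are infinitely many errors, then above any \<open>z\<close> an error
  \<open>x\<close> can be found; it is not frozen, so no number below \<open>x\<close> changes after stage \<open>x\<close>, and
  the approximation to \<open>F(z)\<close> is already correct at stage \<open>x + 1\<close>. The two cases are not
  distinguished effectively, and need not be.
\<close>

section \<open>Recursive functions of lists\<close>

text \<open>Programs carry no arity, so a value is demanded only on lists of length
  \<open>k\<close>. What \<open>f\<close> does elsewhere is irrelevant, which allows
  \<open>hd\<close>, \<open>tl\<close> and \<open>!\<close> inside \<open>f\<close>.\<close>

definition recursive_in :: "nat set \<Rightarrow> nat \<Rightarrow> (nat list \<Rightarrow> nat) \<Rightarrow> bool" where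
  "recursive_in A k f \<longleftrightarrow> (\<exists>p. \<forall>xs. length xs = k \<longrightarrow> run A p xs = Some (f xs))"

text \<open>Tuples of recursive functions serve as the inner functions of a composition. Their
  closure under \<open>#\<close> and \<open>tl\<close> reduces most later recursiveness claims to
  the syntactic shape of the function.\<close>

definition recursive_map :: "nat set \<Rightarrow> nat \<Rightarrow> nat \<Rightarrow> (nat list \<Rightarrow> nat list) \<Rightarrow> bool" where
  "recursive_map A k m F \<longleftrightarrow>
     (\<exists>fs. length fs = m \<and> (\<forall>f\<in>set fs. recursive_in A k f) \<and>
           (\<forall>xs. length xs = k \<longrightarrow> F xs = map (\<lambda>f. f xs) fs))"

lemma recursive_in_cong:
  assumes "recursive_in A k f" and "\<And>xs. length xs = k \<Longrightarrow> f xs = g xs"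
  shows "recursive_in A k g"
  using assms unfolding recursive_in_def by metis

lemma those_eq_Some_iff: "those xs = Some ys \<longleftrightarrow> xs = map Some ys"
  by (induction xs arbitrary: ys) (auto split: option.splits)

lemma recursive_in_comp:
  assumes h: "recursive_in A m h" and F: "recursive_map A k m F"
  shows "recursive_in A k (\<lambda>xs. h (F xs))"
proof -
  obtain p where p: "\<And>xs. length xs = m \<Longrightarrow> run A p xs = Some (h xs)"
    using h unfolding recursive_in_def by blast
  obtain fs where fs: "length fs = m" "\<And>f. f \<in> set fs \<Longrightarrow> recursive_in A k f"
    "\<And>xs. length xs = k \<Longrightarrow> F xs = map (\<lambda>f. f xs) fs"
    using F unfolding recursive_map_def by blast
  obtain q where q: "\<And>f xs. f \<in> set fs \<Longrightarrow> length xs = k \<Longrightarrow> run A (q f) xs = Some (f xs)"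
    using fs(2) unfolding recursive_in_def by metis
  have "run A (Comp p (map q fs)) xs = Some (h (F xs))" if xs: "length xs = k" for xs
  proof -
    have "those (map (\<lambda>q. run A q xs) (map q fs)) = Some (F xs)"
      unfolding those_eq_Some_iff using q xs fs(3) by simp
    then show ?thesis using p fs(1) fs(3)[OF xs] by simp
  qed
  then show ?thesis unfolding recursive_in_def by blast
qed

lemma recursive_in_nth:
  assumes "recursive_map A k m F" and "i < m"
  shows "recursive_in A k (\<lambda>xs. F xs ! i)"
proof -
  obtain fs where fs: "length fs = m" "\<And>f. f \<in> set fs \<Longrightarrow> recursive_in A k f"
    "\<And>xs. length xs = k \<Longrightarrow> F xs = map (\<lambda>f. f xs) fs"
    using assms(1) unfolding recursive_map_def by blast
  have "recursive_in A k (fs ! i)" using fs(1,2) assms(2) by simp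
  then show ?thesis
    by (rule recursive_in_cong) (use fs(1,3) assms(2) in simp)
qed

lemma recursive_map_Nil: "recursive_map A k 0 (\<lambda>xs. [])"
  unfolding recursive_map_def by (rule exI[of _ "[]"]) simp

lemma recursive_map_Cons:
  assumes "recursive_in A k f" and "recursive_map A k m F"
  shows "recursive_map A k (Suc m) (\<lambda>xs. f xs # F xs)"
proof -
  obtain fs where "length fs = m" "\<forall>f\<in>set fs. recursive_in A k f"
    "\<forall>xs. length xs = k \<longrightarrow> F xs = map (\<lambda>f. f xs) fs"
    using assms(2) unfolding recursive_map_def by blast
  with assms(1) show ?thesis
    unfolding recursive_map_def by (intro exI[of _ "f # fs"]) simp
qed

lemma recursive_map_id: "recursive_map A k k (\<lambda>xs. xs)"
  unfolding recursive_map_def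
proof (intro exI conjI ballI allI impI)
  show "length (map (\<lambda>i xs. xs ! i) [0..<k]) = k" by simp
  show "recursive_in A k f" if f: "f \<in> set (map (\<lambda>i xs. xs ! i) [0..<k])" for f
  proof -
    obtain i where "f = (\<lambda>xs. xs ! i)" "i < k" using f by auto
    then show ?thesis unfolding recursive_in_def by (intro exI[of _ "Proj i"]) simp
  qed
  show "xs = map (\<lambda>f. f xs) (map (\<lambda>i xs. xs ! i) [0..<k])" if "length xs = k" for xs
    using that map_nth[of xs] by (simp add: comp_def)
qed

lemma recursive_map_tl:
  assumes "recursive_map A k (Suc m) F"
  shows "recursive_map A k m (\<lambda>xs. tl (F xs))"
proof -
  obtain fs where "length fs = Suc m" "\<forall>f\<in>set fs. recursive_in A k f"
    "\<forall>xs. length xs = k \<longrightarrow> F xs = map (\<lambda>f. f xs) fs"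
    using assms unfolding recursive_map_def by blast
  then show ?thesis
    unfolding recursive_map_def
    by (intro exI[of _ "tl fs"]) (auto simp: map_tl dest: list.set_sel(2)[rotated])
qed

lemma recursive_in_hd:
  assumes "recursive_map A k (Suc m) F"
  shows "recursive_in A k (\<lambda>xs. hd (F xs))"
proof (rule recursive_in_cong[OF recursive_in_nth[OF assms, of 0]])
  fix xs :: "nat list"
  assume xs: "length xs = k"
  obtain fs where "length fs = Suc m" "\<forall>xs. length xs = k \<longrightarrow> F xs = map (\<lambda>f. f xs) fs"
    using assms unfolding recursive_map_def by blast
  then have "length (F xs) = Suc m" using xs by simp
  then show "F xs ! 0 = hd (F xs)" by (metis hd_conv_nth list.size(3) nat.distinct(1))
qed simp

lemmas recursive_in_proj = recursive_in_nth[OF recursive_map_id]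

lemma recursive_in_const: "recursive_in A k (\<lambda>xs. c)"
proof (induction c)
  case 0
  show ?case unfolding recursive_in_def by (rule exI[of _ Zero]) simp
next
  case (Suc c)
  then obtain p where "\<And>xs. length xs = k \<Longrightarrow> run A p xs = Some c"
    unfolding recursive_in_def by blast
  then show ?case unfolding recursive_in_def by (intro exI[of _ "Comp Succ [p]"]) simp
qed

lemma recursive_in_apply:
  assumes p: "\<And>x. run A p [x] = Some (g x)" and f: "recursive_in A k f"
  shows "recursive_in A k (\<lambda>xs. g (f xs))"
proof -
  obtain q where "\<And>xs. length xs = k \<Longrightarrow> run A q xs = Some (f xs)"
    using f unfolding recursive_in_def by blast
  with p show ?thesis unfolding recursive_in_def by (intro exI[of _ "Comp p [q]"]) simp
qed

lemma recursive_in_apply2: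
  assumes p: "\<And>x y. run A p [x, y] = Some (g x y)"
    and f1: "recursive_in A k f1" and f2: "recursive_in A k f2"
  shows "recursive_in A k (\<lambda>xs. g (f1 xs) (f2 xs))"
proof -
  obtain q1 where "\<And>xs. length xs = k \<Longrightarrow> run A q1 xs = Some (f1 xs)"
    using f1 unfolding recursive_in_def by blast
  moreover obtain q2 where "\<And>xs. length xs = k \<Longrightarrow> run A q2 xs = Some (f2 xs)"
    using f2 unfolding recursive_in_def by blast
  ultimately show ?thesis
    using p unfolding recursive_in_def by (intro exI[of _ "Comp p [q1, q2]"]) simp
qed

lemma recursive_in_Suc:
  "recursive_in A k f \<Longrightarrow> recursive_in A k (\<lambda>xs. Suc (f xs))"
  by (rule recursive_in_apply[of A Succ]) simp_all

lemma recursive_in_add: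
  "recursive_in A k f \<Longrightarrow> recursive_in A k g \<Longrightarrow> recursive_in A k (\<lambda>xs. f xs + g xs)"
  by (rule recursive_in_apply2[of A plus_prog]) (simp_all add: run_plus)

lemma recursive_in_half:
  "recursive_in A k f \<Longrightarrow> recursive_in A k (\<lambda>xs. f xs div 2)"
  by (rule recursive_in_apply[of A half_prog]) (simp_all add: run_half)

lemma recursive_in_parity:
  "recursive_in A k f \<Longrightarrow> recursive_in A k (\<lambda>xs. f xs mod 2)"
  by (rule recursive_in_apply[of A parity_prog]) (simp_all add: run_parity)

lemma recursive_in_charf:
  assumes "computable_in A B" and "recursive_in A k f"
  shows "recursive_in A k (\<lambda>xs. charf B (f xs))"
  using assms recursive_in_apply[of A _ "charf B"] unfolding computable_in_def by blast

lemma computable_in_iff_recursive_in: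
  "computable_in A B \<longleftrightarrow> recursive_in A 1 (\<lambda>xs. charf B (xs ! 0))"
proof
  assume "computable_in A B"
  then show "recursive_in A 1 (\<lambda>xs. charf B (xs ! 0))"
    by (rule recursive_in_charf) (rule recursive_in_proj, simp)
next
  assume "recursive_in A 1 (\<lambda>xs. charf B (xs ! 0))"
  then obtain p where p: "\<And>xs. length xs = 1 \<Longrightarrow> run A p xs = Some (charf B (xs ! 0))"
    unfolding recursive_in_def by blast
  have "run A p [x] = Some (charf B x)" for x using p[of "[x]"] by simp
  then show "computable_in A B" unfolding computable_in_def by blast
qed

lemma recursive_in_mono:
  assumes "recursive_in B k f" and "computable_in A B"
  shows "recursive_in A k f"
proof -
  obtain p where p: "\<And>xs. length xs = k \<Longrightarrow> run B p xs = Some (f xs)"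
    using assms(1) unfolding recursive_in_def by blast
  obtain r where "\<And>x. run A r [x] = Some (charf B x)"
    using assms(2) unfolding computable_in_def by blast
  from run_subst_oracle[OF this] p show ?thesis
    unfolding recursive_in_def by metis
qed

text \<open>\<open>PrimRec\<close> recurses on the first argument. The claim is proved for lists
  \<open>n # xs\<close> and then composed with \<open>t xs # xs\<close>, so that the number of steps
  may depend on the parameters.\<close>

lemma recursive_in_rec_nat:
  assumes t: "recursive_in A k t" and g: "recursive_in A k g"
    and h: "recursive_in A (Suc (Suc k)) (\<lambda>ys. h (hd ys) (hd (tl ys)) (tl (tl ys)))"
  shows "recursive_in A k (\<lambda>xs. rec_nat (g xs) (\<lambda>i r. h i r xs) (t xs))"
proof -
  obtain p where p: "\<And>xs. length xs = k \<Longrightarrow> run A p xs = Some (g xs)"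
    using g unfolding recursive_in_def by blast
  obtain q where q: "\<And>xs. length xs = Suc (Suc k) \<Longrightarrow>
      run A q xs = Some (h (hd xs) (hd (tl xs)) (tl (tl xs)))"
    using h unfolding recursive_in_def by blast
  have "run A (PrimRec p q) (n # xs) = Some (rec_nat (g xs) (\<lambda>i r. h i r xs) n)"
    if xs: "length xs = k" for n xs
  proof -
    have "rec_nat (Some (g xs)) (\<lambda>k r. Option.bind r (\<lambda>v. run A q (k # v # xs))) n
      = Some (rec_nat (g xs) (\<lambda>i r. h i r xs) n)"
      by (induction n) (simp_all add: q xs)
    then show ?thesis by (simp add: p xs)
  qed
  then have "recursive_in A (Suc k) (\<lambda>ys. rec_nat (g (tl ys)) (\<lambda>i r. h i r (tl ys)) (hd ys))"
    unfolding recursive_in_def by (intro exI[of _ "PrimRec p q"]) (auto simp: length_Suc_conv)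
  from recursive_in_comp[OF this recursive_map_Cons[OF t recursive_map_id]]
  show ?thesis by simp
qed

section \<open>Bounded sums, arithmetic, connectives and comparisons\<close>

lemma recursive_in_sum:
  assumes t: "recursive_in A k t"
    and f: "recursive_in A (Suc k) (\<lambda>ys. f (hd ys) (tl ys))"
  shows "recursive_in A k (\<lambda>xs. \<Sum>i<t xs. f i xs)"
proof -
  \<comment> \<open>The step function of the recursion receives index, accumulator and parameters;
    the summand must not see the accumulator.\<close>
  have "recursive_map A (Suc (Suc k)) (Suc k) (\<lambda>ys. hd ys # tl (tl ys))"
    by (intro recursive_map_Cons recursive_in_hd recursive_map_tl) (rule recursive_map_id)+
  from recursive_in_comp[OF f this]
  have f': "recursive_in A (Suc (Suc k)) (\<lambda>ys. f (hd ys) (tl (tl ys)))" by simp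
  have "recursive_in A k (\<lambda>xs. rec_nat 0 (\<lambda>i r. r + f i xs) (t xs))"
    by (intro recursive_in_rec_nat t recursive_in_const recursive_in_add f' recursive_in_hd
        recursive_map_tl) (rule recursive_map_id)
  moreover have "rec_nat 0 (\<lambda>i r. r + f i xs) n = (\<Sum>i<n. f i xs)" for n xs
    by (induction n) simp_all
  ultimately show ?thesis by simp
qed

lemma recursive_in_mult:
  assumes "recursive_in A k f" and "recursive_in A k g"
  shows "recursive_in A k (\<lambda>xs. f xs * g xs)"
proof -
  have "recursive_in A k (\<lambda>xs. \<Sum>i<f xs. g xs)"
    by (intro recursive_in_sum assms recursive_in_comp[OF assms(2)] recursive_map_tl)
      (rule recursive_map_id)
  then show ?thesis by simp
qed

lemma recursive_in_pred:
  assumes "recursive_in A k f"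
  shows "recursive_in A k (\<lambda>xs. f xs - 1)"
proof -
  have "recursive_in A k (\<lambda>xs. rec_nat 0 (\<lambda>i r. i) (f xs))"
    by (intro recursive_in_rec_nat assms recursive_in_const recursive_in_hd) (rule recursive_map_id)
  moreover have "rec_nat 0 (\<lambda>i r. i) n = n - 1" for n by (cases n) simp_all
  ultimately show ?thesis by simp
qed

lemma recursive_in_diff:
  assumes "recursive_in A k f" and "recursive_in A k g"
  shows "recursive_in A k (\<lambda>xs. f xs - g xs)"
proof -
  have "recursive_in A k (\<lambda>xs. rec_nat (f xs) (\<lambda>i r. r - 1) (g xs))"
    by (intro recursive_in_rec_nat assms recursive_in_pred recursive_in_hd recursive_map_tl)
      (rule recursive_map_id)
  moreover have "rec_nat m (\<lambda>i r. r - 1) n = m - n" for m n :: nat by (induction n) simp_all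
  ultimately show ?thesis by simp
qed

lemma recursive_in_not:
  assumes "recursive_in A k (\<lambda>xs. of_bool (P xs))"
  shows "recursive_in A k (\<lambda>xs. of_bool (\<not> P xs))"
  by (rule recursive_in_cong[OF recursive_in_diff[OF recursive_in_const[of _ _ 1] assms]]) simp

lemma recursive_in_conj:
  assumes "recursive_in A k (\<lambda>xs. of_bool (P xs))" and "recursive_in A k (\<lambda>xs. of_bool (Q xs))"
  shows "recursive_in A k (\<lambda>xs. of_bool (P xs \<and> Q xs))"
  by (rule recursive_in_cong[OF recursive_in_mult[OF assms]]) simp

lemma recursive_in_disj:
  assumes "recursive_in A k (\<lambda>xs. of_bool (P xs))" and "recursive_in A k (\<lambda>xs. of_bool (Q xs))"
  shows "recursive_in A k (\<lambda>xs. of_bool (P xs \<or> Q xs))"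
  using recursive_in_not[OF recursive_in_conj[OF recursive_in_not recursive_in_not], OF assms]
  by simp

text \<open>Subtraction is truncated, so \<open>f - g\<close> vanishes exactly when
  \<open>f \<le> g\<close>, and subtracting it from \<open>1\<close> gives the truth value.\<close>

lemma recursive_in_le:
  assumes "recursive_in A k f" and "recursive_in A k g"
  shows "recursive_in A k (\<lambda>xs. of_bool (f xs \<le> g xs))"
  by (rule recursive_in_cong[OF recursive_in_diff[OF recursive_in_const[of _ _ 1]
        recursive_in_diff[OF assms]]]) auto

lemma recursive_in_less:
  assumes "recursive_in A k f" and "recursive_in A k g"
  shows "recursive_in A k (\<lambda>xs. of_bool (f xs < g xs))"
  using recursive_in_not[OF recursive_in_le[OF assms(2,1)]] by (simp add: not_le)

lemma recursive_in_eq: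
  assumes "recursive_in A k f" and "recursive_in A k g"
  shows "recursive_in A k (\<lambda>xs. of_bool (f xs = g xs))"
  using recursive_in_conj[OF recursive_in_le[OF assms] recursive_in_le[OF assms(2,1)]]
  by (simp add: order_eq_iff)

lemma recursive_in_if:
  assumes "recursive_in A k (\<lambda>xs. of_bool (P xs))" and "recursive_in A k f" and "recursive_in A k g"
  shows "recursive_in A k (\<lambda>xs. if P xs then f xs else g xs)"
  by (rule recursive_in_cong[OF recursive_in_add[OF recursive_in_mult[OF assms(1,2)]
        recursive_in_mult[OF recursive_in_not[OF assms(1)] assms(3)]]]) simp

lemma recursive_in_mem:
  assumes "computable_in A B" and "recursive_in A k f"
  shows "recursive_in A k (\<lambda>xs. of_bool (f xs \<in> B))"
  by (rule recursive_in_cong[OF recursive_in_charf[OF assms]]) (simp add: charf_def)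

text \<open>The root of \<open>n\<close> is the number of positive integers whose square is at most
  \<open>n\<close>, which a bounded sum counts.\<close>

lemma recursive_in_floor_sqrt:
  assumes "recursive_in A k f"
  shows "recursive_in A k (\<lambda>xs. floor_sqrt (f xs))"
proof -
  have "recursive_in A k (\<lambda>xs. \<Sum>i<f xs. of_bool (Suc i * Suc i \<le> f xs))"
    by (intro recursive_in_sum recursive_in_le recursive_in_mult recursive_in_Suc recursive_in_hd
        assms recursive_in_comp[OF assms] recursive_map_tl) (rule recursive_map_id)+
  moreover have "(\<Sum>i<n. of_bool (Suc i * Suc i \<le> n)) = floor_sqrt n" for n :: nat
  proof -
    have iff: "Suc i * Suc i \<le> n \<longleftrightarrow> i < floor_sqrt n" for i
      using le_floor_sqrt_iff[of "Suc i" n] by (simp only: power2_eq_square Suc_le_eq)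
    have "{..<n} \<inter> {i. i < floor_sqrt n} = {..<floor_sqrt n}"
      using floor_sqrt_le[of n] by (auto intro: less_le_trans)
    then show ?thesis unfolding iff by simp
  qed
  ultimately show ?thesis by simp
qed

section \<open>Unbounded search\<close>

lemma run_Mu_total:
  assumes "\<And>n. run A p (n # xs) = Some (h n)"
  shows "run A (Mu p) xs = (if \<exists>n. h n = 0 then Some (LEAST n. h n = 0) else None)"
proof -
  \<comment> \<open>\<open>Mu\<close> also demands that all earlier values be defined and nonzero.
    For a total inner program this only expresses that \<open>n\<close> is the first zero.\<close>
  let ?H = "\<lambda>n. h n = 0 \<and> (\<forall>m<n. \<exists>k. h m = Suc k)"
  have iff: "?H n \<longleftrightarrow> n = (LEAST n. h n = 0)" if "\<exists>n. h n = 0" for n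
  proof
    assume n: "?H n"
    have "(LEAST n. h n = 0) = n"
    proof (rule Least_equality)
      show "n \<le> m" if "h m = 0" for m
        using n that by (metis nat.distinct(1) not_less)
    qed (use n in simp)
    then show "n = (LEAST n. h n = 0)" by simp
  next
    assume "n = (LEAST n. h n = 0)"
    then show "?H n"
      using LeastI_ex[OF that] not_less_Least[of _ "\<lambda>n. h n = 0"] not0_implies_Suc by blast
  qed
  have "(\<exists>n. ?H n) \<longleftrightarrow> (\<exists>n. h n = 0)" using iff by blast
  moreover have "(LEAST n. ?H n) = (LEAST n. h n = 0)" if ex: "\<exists>n. h n = 0"
    unfolding iff[OF ex] by (rule Least_equality) simp_all
  ultimately show ?thesis by (simp only: run.simps Let_def assms option.inject cong: if_cong)
qed

lemma recursive_in_Least: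
  assumes h: "recursive_in A (Suc k) (\<lambda>ys. of_bool (P (hd ys) (tl ys)))"
    and ex: "\<And>xs. length xs = k \<Longrightarrow> \<exists>n. P n xs"
  shows "recursive_in A k (\<lambda>xs. LEAST n. P n xs)"
proof -
  obtain p where p: "\<And>ys. length ys = Suc k \<Longrightarrow> run A p ys = Some (of_bool (\<not> P (hd ys) (tl ys)))"
    using recursive_in_not[OF h] unfolding recursive_in_def by blast
  have "run A (Mu p) xs = Some (LEAST n. P n xs)" if "length xs = k" for xs
    using run_Mu_total[of A p xs "\<lambda>n. of_bool (\<not> P n xs)"] p ex[OF that] that by simp
  then show ?thesis unfolding recursive_in_def by blast
qed

text \<open>A search for \<open>n\<close> halts exactly when a witness exists. The witness comes
  first in the list because \<open>Mu\<close> puts its search variable in front; \<open>P\<close> is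
  negated because \<open>Mu\<close> looks for a zero.\<close>

lemma ce_in_Ex:
  assumes h: "recursive_in A 2 (\<lambda>ys. of_bool (P (hd ys) (hd (tl ys))))"
  shows "ce_in A {x. \<exists>n. P n x}"
proof -
  obtain p where p: "\<And>ys. length ys = 2 \<Longrightarrow>
      run A p ys = Some (of_bool (\<not> P (hd ys) (hd (tl ys))))"
    using recursive_in_not[OF h] unfolding recursive_in_def by blast
  have "run A (Mu p) [x] \<noteq> None \<longleftrightarrow> (\<exists>n. P n x)" for x
  proof -
    have "run A p [n, x] = Some (of_bool (\<not> P n x))" for n using p[of "[n, x]"] by simp
    then show ?thesis by (subst run_Mu_total) auto
  qed
  then show ?thesis unfolding ce_in_def by (intro exI[of _ "Mu p"]) blast
qed


section \<open>Recursive stages of a computation\<close>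

text \<open>
  \<open>h (n # xs)\<close> is the successor of the value on \<open>xs\<close> if the first \<open>n\<close> steps suffice to find it, and
  \<open>0\<close> otherwise.
\<close>

definition stages :: "nat set \<Rightarrow> nat \<Rightarrow> prog \<Rightarrow> (nat list \<Rightarrow> nat) \<Rightarrow> bool" where
  "stages A k p h \<longleftrightarrow> recursive_in A (Suc k) h \<and>
     (\<forall>xs. length xs = k \<longrightarrow>
        (\<forall>n m. n \<le> m \<longrightarrow> h (n # xs) \<noteq> 0 \<longrightarrow> h (m # xs) = h (n # xs)) \<and>
        (\<forall>v. run A p xs = Some v \<longleftrightarrow> (\<exists>n. h (n # xs) = Suc v)))"

lemma stages_recursive: "stages A k p h \<Longrightarrow> recursive_in A (Suc k) h"
  by (simp add: stages_def)

lemma stages_mono: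
  "stages A k p h \<Longrightarrow> length xs = k \<Longrightarrow> h (n # xs) = Suc v \<Longrightarrow> n \<le> m \<Longrightarrow> h (m # xs) = Suc v"
  unfolding stages_def by simp

lemma stages_iff:
  "stages A k p h \<Longrightarrow> length xs = k \<Longrightarrow> run A p xs = Some v \<longleftrightarrow> (\<exists>n. h (n # xs) = Suc v)"
  by (simp add: stages_def)

text \<open>In this form finitely many subcomputations can be awaited at once, without choosing a
  common bound by hand.\<close>

lemma stages_eventually:
  assumes "stages A k p h" and "length xs = k" and "run A p xs = Some v"
  shows "\<forall>\<^sub>F n in sequentially. h (n # xs) = Suc v"
proof -
  obtain n where "h (n # xs) = Suc v" using stages_iff[OF assms(1,2)] assms(3) by blast
  from stages_mono[OF assms(1,2) this] show ?thesis unfolding eventually_sequentially by blast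
qed

lemma stages_sound:
  "stages A k p h \<Longrightarrow> length xs = k \<Longrightarrow> h (n # xs) = Suc v \<Longrightarrow> run A p xs = Some v"
  using stages_iff by blast

lemma stagesI:
  assumes "recursive_in A (Suc k) h"
    and "\<And>xs n m v. length xs = k \<Longrightarrow> n \<le> m \<Longrightarrow> h (n # xs) = Suc v \<Longrightarrow> h (m # xs) = Suc v"
    and "\<And>xs n v. length xs = k \<Longrightarrow> h (n # xs) = Suc v \<Longrightarrow> run A p xs = Some v"
    and "\<And>xs v. length xs = k \<Longrightarrow> run A p xs = Some v \<Longrightarrow> \<exists>n. h (n # xs) = Suc v"
  shows "stages A k p h"
  unfolding stages_def
proof (intro conjI allI impI)
  show "recursive_in A (Suc k) h" by (rule assms(1))
next
  fix xs :: "nat list" and n m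
  assume "length xs = k" "n \<le> m" "h (n # xs) \<noteq> 0"
  then show "h (m # xs) = h (n # xs)"
    using assms(2)[of xs n m "h (n # xs) - 1"] by simp
next
  fix xs :: "nat list" and v
  assume xs: "length xs = k"
  show "run A p xs = Some v \<longleftrightarrow> (\<exists>n. h (n # xs) = Suc v)"
    using assms(3,4)[OF xs] by blast
qed

section \<open>Stages for each program constructor\<close>

lemma stages_None:
  assumes "\<And>xs. length xs = k \<Longrightarrow> run A p xs = None"
  shows "stages A k p (\<lambda>zs. 0)"
  by (rule stagesI) (simp_all add: assms recursive_in_const)

lemma stages_total:
  assumes "recursive_in A k f" and "\<And>xs. length xs = k \<Longrightarrow> run A p xs = Some (f xs)"
  shows "stages A k p (\<lambda>zs. Suc (f (tl zs)))"
proof (rule stagesI)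
  show "recursive_in A (Suc k) (\<lambda>zs. Suc (f (tl zs)))"
    by (intro recursive_in_Suc recursive_in_comp[OF assms(1)] recursive_map_tl recursive_map_id)
qed (simp_all add: assms(2))

lemma recursive_in_Ball_list:
  assumes "\<And>q. q \<in> set qs \<Longrightarrow> recursive_in A k (\<lambda>xs. of_bool (P q xs))"
  shows "recursive_in A k (\<lambda>xs. of_bool (\<forall>q\<in>set qs. P q xs))"
  using assms
proof (induction qs)
  case Nil
  show ?case by (simp add: recursive_in_const)
next
  case (Cons q qs)
  have "recursive_in A k (\<lambda>xs. of_bool (P q xs \<and> (\<forall>q\<in>set qs. P q xs)))"
    by (intro recursive_in_conj Cons.IH Cons.prems) simp_all
  then show ?case by simp
qed

text \<open>One bound serves the outer program and all inner ones. The outer program is started only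
  when every inner value is known; \<open>- 1\<close> undoes the successor that marks a known
  value.\<close>

lemma stages_Comp:
  assumes p: "stages A (length qs) p hp"
    and q: "\<And>q. q \<in> set qs \<Longrightarrow> stages A k q (hq q)"
  shows "stages A k (Comp p qs)
    (\<lambda>zs. if \<forall>q\<in>set qs. hq q zs \<noteq> 0 then hp (hd zs # map (\<lambda>q. hq q zs - 1) qs) else 0)"
    (is "stages A k _ ?h")
proof (rule stagesI)
  have "recursive_map A (Suc k) (length qs) (\<lambda>zs. map (\<lambda>q. hq q zs - 1) qs)"
    unfolding recursive_map_def
    by (intro exI[of _ "map (\<lambda>q zs. hq q zs - 1) qs"])
      (use recursive_in_pred[OF stages_recursive[OF q]] in auto)
  then show "recursive_in A (Suc k) ?h"
    by (intro recursive_in_if recursive_in_Ball_list recursive_in_not recursive_in_eq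
        stages_recursive[OF q] recursive_in_const recursive_in_comp[OF stages_recursive[OF p]]
        recursive_map_Cons recursive_in_hd) (rule recursive_map_id | assumption)+
next
  fix xs n m v
  assume xs: "length xs = k" and le: "n \<le> m" and n: "?h (n # xs) = Suc v"
  then have nz: "\<forall>q\<in>set qs. hq q (n # xs) \<noteq> 0" by (auto split: if_splits)
  have eq: "hq q (m # xs) = hq q (n # xs)" if "q \<in> set qs" for q
    using stages_mono[OF q[OF that] xs _ le, of "hq q (n # xs) - 1"] nz that by simp
  then have "map (\<lambda>q. hq q (m # xs) - 1) qs = map (\<lambda>q. hq q (n # xs) - 1) qs" by simp
  moreover have "hp (n # map (\<lambda>q. hq q (n # xs) - 1) qs) = Suc v"
    using n nz by simp
  ultimately have "hp (m # map (\<lambda>q. hq q (m # xs) - 1) qs) = Suc v"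
    by (metis length_map stages_mono[OF p _ _ le])
  then show "?h (m # xs) = Suc v" using nz eq by simp
next
  fix xs n v
  assume xs: "length xs = k" and n: "?h (n # xs) = Suc v"
  then have nz: "\<forall>q\<in>set qs. hq q (n # xs) \<noteq> 0" by (auto split: if_splits)
  have "run A q xs = Some (hq q (n # xs) - 1)" if "q \<in> set qs" for q
    using stages_sound[OF q[OF that] xs, of n "hq q (n # xs) - 1"] nz that by simp
  then have "those (map (\<lambda>q. run A q xs) qs) = Some (map (\<lambda>q. hq q (n # xs) - 1) qs)"
    unfolding those_eq_Some_iff by simp
  moreover have "run A p (map (\<lambda>q. hq q (n # xs) - 1) qs) = Some v"
    using n nz by (intro stages_sound[OF p, of _ n]) simp_all
  ultimately show "run A (Comp p qs) xs = Some v" by simp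
next
  fix xs v
  assume xs: "length xs = k" and "run A (Comp p qs) xs = Some v"
  then obtain ws where "those (map (\<lambda>q. run A q xs) qs) = Some ws" and w: "run A p ws = Some v"
    by (auto simp: bind_eq_Some_conv)
  then have ws: "map (\<lambda>q. run A q xs) qs = map Some ws" by (simp add: those_eq_Some_iff)
  \<comment> \<open>Values are indexed by programs rather than by positions in \<open>qs\<close>,
    which is harmless because equal programs have equal values.\<close>
  define f where "f q = the (run A q xs)" for q
  have run: "run A q xs = Some (f q)" if "q \<in> set qs" for q
  proof -
    have "run A q xs \<in> set (map Some ws)" using that unfolding ws[symmetric] by simp
    then show ?thesis by (auto simp: f_def)
  qed
  have len: "length ws = length qs" using arg_cong[OF ws, of length] by simp
  have "map Some (map f qs) = map Some ws" unfolding ws[symmetric] by (simp add: run)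
  then have wsf: "ws = map f qs" by (metis inj_Some inj_map_eq_map)
  have "\<forall>\<^sub>F n in sequentially. \<forall>q\<in>set qs. hq q (n # xs) = Suc (f q)"
    by (intro eventually_ball_finite) (auto intro: stages_eventually[OF q xs] run)
  moreover have "\<forall>\<^sub>F n in sequentially. hp (n # ws) = Suc v"
    by (rule stages_eventually[OF p len w])
  ultimately have "\<forall>\<^sub>F n in sequentially. ?h (n # xs) = Suc v"
  proof eventually_elim
    case (elim n)
    then have "map (\<lambda>q. hq q (n # xs) - 1) qs = ws" unfolding wsf by simp
    with elim show ?case by simp
  qed
  then show "\<exists>n. ?h (n # xs) = Suc v" unfolding eventually_sequentially by blast
qed

text \<open>All levels of the recursion share one bound, and a \<open>0\<close> at some level,
  meaning that no value is known yet, is passed on to all later levels.\<close>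

lemma stages_PrimRec:
  assumes p: "stages A k p hp" and q: "stages A (Suc (Suc k)) q hq"
  shows "stages A (Suc k) (PrimRec p q) (\<lambda>zs. rec_nat (hp (hd zs # tl (tl zs)))
    (\<lambda>i r. if r = 0 then 0 else hq (hd zs # i # (r - 1) # tl (tl zs))) (hd (tl zs)))"
    (is "stages A _ _ ?h")
proof -
  define R where "R n m ys = rec_nat (hp (n # ys))
    (\<lambda>i r. if r = 0 then 0 else hq (n # i # (r - 1) # ys)) m" for n m ys
  define S where "S m ys = rec_nat (run A p ys) (\<lambda>k r. Option.bind r (\<lambda>v. run A q (k # v # ys))) m"
    for m ys
  have R_0: "R n 0 ys = hp (n # ys)" for n ys by (simp add: R_def)
  have R_Suc: "R n (Suc m) ys = Suc v \<longleftrightarrow>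
    (\<exists>u. R n m ys = Suc u \<and> hq (n # m # u # ys) = Suc v)" for n m ys v
    by (cases "R n m ys") (simp_all add: R_def)
  have S_0: "S 0 ys = run A p ys" for ys by (simp add: S_def)
  have S_Suc: "S (Suc m) ys = Some v \<longleftrightarrow> (\<exists>u. S m ys = Some u \<and> run A q (m # u # ys) = Some v)"
    for m ys v by (simp add: S_def bind_eq_Some_conv)
  have mono: "R n' m ys = Suc v" if "length ys = k" "n \<le> n'" "R n m ys = Suc v" for n n' m ys v
    using that(3)
  proof (induction m arbitrary: v)
    case 0
    then show ?case using stages_mono[OF p that(1) _ that(2)] by (simp add: R_0)
  next
    case (Suc m)
    then show ?case using stages_mono[OF q _ _ that(2)] that(1) unfolding R_Suc by auto
  qed
  have iff: "S m ys = Some v \<longleftrightarrow> (\<exists>n. R n m ys = Suc v)" if ys: "length ys = k" for m ys v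
  proof (induction m arbitrary: v)
    case 0
    show ?case using stages_iff[OF p ys] by (simp add: S_0 R_0)
  next
    case (Suc m)
    \<comment> \<open>The previous value and the next step may become known at different stages; by
      monotonicity both are known at the maximum of the two.\<close>
    have C: "(\<exists>n1. R n1 m ys = Suc u) \<and> (\<exists>n2. hq (n2 # m # u # ys) = Suc v) \<longleftrightarrow>
      (\<exists>n. R n m ys = Suc u \<and> hq (n # m # u # ys) = Suc v)" for u
    proof
      assume "(\<exists>n1. R n1 m ys = Suc u) \<and> (\<exists>n2. hq (n2 # m # u # ys) = Suc v)"
      then obtain n1 n2 where n: "R n1 m ys = Suc u" "hq (n2 # m # u # ys) = Suc v" by blast
      have "R (max n1 n2) m ys = Suc u" using mono[OF ys _ n(1)] by simp
      moreover have "hq (max n1 n2 # m # u # ys) = Suc v"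
        using stages_mono[OF q _ n(2)] ys by simp
      ultimately show "\<exists>n. R n m ys = Suc u \<and> hq (n # m # u # ys) = Suc v" by blast
    qed blast
    have "run A q (m # u # ys) = Some v \<longleftrightarrow> (\<exists>n. hq (n # m # u # ys) = Suc v)" for u
      by (rule stages_iff[OF q]) (simp add: ys)
    then have "S (Suc m) ys = Some v \<longleftrightarrow> (\<exists>u n. R n m ys = Suc u \<and> hq (n # m # u # ys) = Suc v)"
      unfolding S_Suc Suc.IH by (simp only: C)
    then show ?case unfolding R_Suc by blast
  qed
  have run: "run A (PrimRec p q) (m # ys) = S m ys" for m ys by (simp add: S_def)
  have h: "?h (n # m # ys) = R n m ys" for n m ys by (simp only: R_def list.sel)
  show ?thesis
  proof (rule stagesI)
    show "recursive_in A (Suc (Suc k)) ?h"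
      by (intro recursive_in_rec_nat recursive_in_if recursive_in_eq recursive_in_const
          recursive_in_comp[OF stages_recursive[OF p]] recursive_in_comp[OF stages_recursive[OF q]]
          recursive_map_Cons recursive_in_pred recursive_in_hd recursive_map_tl)
        (rule recursive_map_id)+
  next
    fix xs :: "nat list" and n n' v
    assume "length xs = Suc k"
    then obtain m ys where xs: "xs = m # ys" and ys: "length ys = k" by (auto simp: length_Suc_conv)
    show "?h (n' # xs) = Suc v" if "n \<le> n'" "?h (n # xs) = Suc v"
      using mono[OF ys that(1)] that(2) unfolding xs h by blast
    show "run A (PrimRec p q) xs = Some v" if "?h (n # xs) = Suc v"
      using iff[OF ys] that unfolding xs h run by blast
    show "\<exists>n. ?h (n # xs) = Suc v" if "run A (PrimRec p q) xs = Some v"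
      using iff[OF ys] that unfolding xs h run by blast
  qed
qed

text \<open>At bound \<open>n\<close> only candidates \<open>m < n\<close> are tried. A stage value
  \<open>1\<close> means that the result \<open>0\<close> is known, and the inner sum counts the
  earlier arguments not yet known to have a nonzero result. At most one \<open>m\<close> passes both
  tests, so the outer sum is \<open>Suc m\<close> for that \<open>m\<close>, or
  \<open>0\<close>.\<close>

lemma stages_Mu:
  assumes p: "stages A (Suc k) p hp"
  shows "stages A k (Mu p) (\<lambda>zs. \<Sum>m<hd zs. of_bool (hp (hd zs # m # tl zs) = 1 \<and>
    (\<Sum>i<m. of_bool (hp (hd zs # i # tl zs) \<le> 1)) = (0::nat)) * Suc m)"
    (is "stages A k _ ?h")
proof -
  define G where "G n m xs \<longleftrightarrow> hp (n # m # xs) = 1 \<and> (\<forall>i<m. \<exists>j. hp (n # i # xs) = Suc (Suc j))"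
    for n m xs
  have G_unique: "m = m'" if "G n m xs" "G n m' xs" for n m m' xs
    using that unfolding G_def by (metis One_nat_def linorder_neqE_nat nat.distinct(1) nat.inject)
  have h_eq: "?h (n # xs) = (\<Sum>m<n. of_bool (G n m xs) * Suc m)" for n xs
  proof -
    have le: "(hp (n # i # xs) \<le> 1) \<longleftrightarrow> \<not> (\<exists>j. hp (n # i # xs) = Suc (Suc j))" for i
      by (cases "hp (n # i # xs)"; cases "hp (n # i # xs) - 1") auto
    then have "(\<Sum>i<m. of_bool (hp (n # i # xs) \<le> 1)) = (0::nat) \<longleftrightarrow>
      (\<forall>i<m. \<exists>j. hp (n # i # xs) = Suc (Suc j))" for m
      unfolding le by (subst sum_eq_0_iff) auto
    then show ?thesis by (simp add: G_def)
  qed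
  have h_iff: "?h (n # xs) = Suc v \<longleftrightarrow> v < n \<and> G n v xs" for n v xs
  proof -
    have single: "(\<Sum>m<n. of_bool (G n m xs) * Suc m) = Suc u" if "u < n" "G n u xs" for u
    proof -
      have "G n m xs \<longleftrightarrow> m = u" for m using G_unique that(2) by blast
      then have "of_bool (G n m xs) * Suc m = (if m = u then Suc m else 0)" for m by simp
      then show ?thesis using that(1) by simp
    qed
    show ?thesis
    proof (cases "\<exists>u<n. G n u xs")
      case True
      then obtain u where "u < n" "G n u xs" by blast
      with single[of u] G_unique show ?thesis unfolding h_eq by (metis nat.inject)
    next
      case False
      then have "(\<Sum>m<n. of_bool (G n m xs) * Suc m) = 0" by (intro sum.neutral) auto
      then show ?thesis using False unfolding h_eq by auto
    qed
  qed
  have G_mono: "G m v xs" if "length xs = k" "n \<le> m" "G n v xs" for n m v xs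
    using stages_mono[OF p _ _ that(2)] that(1,3) unfolding G_def One_nat_def
    by (metis length_Cons)
  define H where "H v xs \<longleftrightarrow> run A p (v # xs) = Some 0 \<and>
    (\<forall>m<v. \<exists>j. run A p (m # xs) = Some (Suc j))" for v xs
  have run: "run A (Mu p) xs = Some v \<longleftrightarrow> H v xs" for v xs
  proof -
    have unique: "v = w" if "H v xs" "H w xs" for v w
      using that unfolding H_def by (metis linorder_neqE_nat nat.distinct(1) option.inject)
    have "(LEAST v. H v xs) = w" if "H w xs" for w
      using unique[OF that] LeastI[of "\<lambda>v. H v xs", OF that] by metis
    then show ?thesis by (auto simp: Let_def simp flip: H_def)
  qed
  have G_H: "H v xs" if "length xs = k" "G n v xs" for n v xs
    using that stages_sound[OF p] unfolding G_def H_def One_nat_def by (metis length_Cons)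
  have H_G: "\<exists>n>v. G n v xs" if xs: "length xs = k" and H: "H v xs" for v xs
  proof -
    have "\<forall>\<^sub>F n in sequentially. \<forall>i\<in>{..<v}. \<exists>j. hp (n # i # xs) = Suc (Suc j)"
    proof (intro eventually_ball_finite ballI)
      fix i assume "i \<in> {..<v}"
      then obtain j where "run A p (i # xs) = Some (Suc j)" using H unfolding H_def by auto
      then have "\<forall>\<^sub>F n in sequentially. hp (n # i # xs) = Suc (Suc j)"
        by (intro stages_eventually[OF p]) (simp_all add: xs)
      then show "\<forall>\<^sub>F n in sequentially. \<exists>j. hp (n # i # xs) = Suc (Suc j)"
        by eventually_elim blast
    qed simp
    moreover have "\<forall>\<^sub>F n in sequentially. hp (n # v # xs) = Suc 0"
      using H by (intro stages_eventually[OF p]) (simp_all add: xs H_def)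
    \<comment> \<open>The bound must also exceed \<open>v\<close> itself for \<open>v\<close> to be
      among the candidates.\<close>
    moreover have "\<forall>\<^sub>F n in sequentially. v < n" by (rule eventually_gt_at_top)
    ultimately have "\<forall>\<^sub>F n in sequentially. v < n \<and> G n v xs"
      by eventually_elim (simp add: G_def)
    then show ?thesis unfolding eventually_sequentially by blast
  qed
  show ?thesis
  proof (rule stagesI)
    show "recursive_in A (Suc k) ?h"
      by (intro recursive_in_sum recursive_in_mult recursive_in_conj recursive_in_eq
          recursive_in_le recursive_in_const recursive_in_Suc
          recursive_in_comp[OF stages_recursive[OF p]]
          recursive_map_Cons recursive_in_hd recursive_map_tl)
        (rule recursive_map_id)+
  next
    fix xs :: "nat list" and n m v
    assume xs: "length xs = k"
    show "?h (m # xs) = Suc v" if "n \<le> m" "?h (n # xs) = Suc v"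
      using G_mono[OF xs that(1)] that unfolding h_iff by simp
    show "run A (Mu p) xs = Some v" if "?h (n # xs) = Suc v"
      using G_H[OF xs] that unfolding h_iff run by blast
    show "\<exists>n. ?h (n # xs) = Suc v" if "run A (Mu p) xs = Some v"
      using H_G[OF xs] that unfolding h_iff run by blast
  qed
qed

text \<open>This takes the place of a normal form theorem. The stage function is built along the
  structure of the program, so programs need no numerical codes. Arities too small for a program
  make it diverge, and there the zero function works.\<close>

theorem ex_stages: "\<exists>h. stages A k p h"
proof (induction p arbitrary: k)
  case Zero
  show ?case using stages_total[OF recursive_in_const[of A k 0], of Zero] by auto
next
  case Succ
  show ?case
  proof (cases k)
    case 0
    then show ?thesis using stages_None[of k A Succ] by auto
  next
    case (Suc k')
    have "recursive_in A k (\<lambda>xs. Suc (xs ! 0))"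
      unfolding Suc by (intro recursive_in_Suc recursive_in_proj) simp
    moreover have "run A Succ xs = Some (Suc (xs ! 0))" if "length xs = k" for xs
      using that Suc by (cases xs) simp_all
    ultimately show ?thesis using stages_total by blast
  qed
next
  case (Proj i)
  show ?case
  proof (cases "i < k")
    case True
    then have "stages A k (Proj i) (\<lambda>zs. Suc (tl zs ! i))"
      by (intro stages_total recursive_in_proj) simp_all
    then show ?thesis by blast
  next
    case False
    then show ?thesis using stages_None[of k A "Proj i"] by auto
  qed
next
  case Oracle
  show ?case
  proof (cases k)
    case 0
    then show ?thesis using stages_None[of k A Oracle] by auto
  next
    case (Suc k')
    have "recursive_in A k (\<lambda>xs. charf A (xs ! 0))"
      unfolding Suc by (intro recursive_in_charf computable_in_refl recursive_in_proj) simp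
    moreover have "run A Oracle xs = Some (charf A (xs ! 0))" if "length xs = k" for xs
      using that Suc by (cases xs) simp_all
    ultimately show ?thesis using stages_total by blast
  qed
next
  case (Comp p qs)
  obtain hp where "stages A (length qs) p hp" using Comp.IH(1) by blast
  moreover have "\<forall>q\<in>set qs. \<exists>h. stages A k q h" using Comp.IH(2) by blast
  then obtain hq where "\<And>q. q \<in> set qs \<Longrightarrow> stages A k q (hq q)" by metis
  ultimately show ?case by (intro exI) (rule stages_Comp)
next
  case (PrimRec p q)
  show ?case
  proof (cases k)
    case 0
    then show ?thesis using stages_None[of k A "PrimRec p q"] by auto
  next
    case (Suc k')
    obtain hp hq where "stages A k' p hp" "stages A (Suc (Suc k')) q hq"
      using PrimRec.IH by blast
    then show ?thesis unfolding Suc by (intro exI) (rule stages_PrimRec)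
  qed
next
  case (Mu p)
  then obtain hp where "stages A (Suc k) p hp" by blast
  then show ?case by (intro exI) (rule stages_Mu)
qed

text \<open>\<open>h [n, x] \<noteq> 0\<close> says that \<open>x\<close> has been enumerated by
  stage \<open>n\<close>. Monotonicity in \<open>n\<close> later lets a search use any sufficiently
  large number as the stage.\<close>

lemma ce_in_stages:
  assumes "ce_in A W"
  obtains h where "recursive_in A 2 h" and "\<And>x n m. n \<le> m \<Longrightarrow> h [n, x] \<noteq> 0 \<Longrightarrow> h [m, x] \<noteq> 0"
    and "\<And>x. x \<in> W \<longleftrightarrow> (\<exists>n. h [n, x] \<noteq> 0)"
proof -
  obtain p where p: "\<And>x. x \<in> W \<longleftrightarrow> run A p [x] \<noteq> None"
    using assms unfolding ce_in_def by blast
  obtain h where h: "stages A 1 p h" using ex_stages by blast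
  show thesis
  proof
    show "recursive_in A 2 h" using stages_recursive[OF h] by (simp add: numeral_2_eq_2)
    show "h [m, x] \<noteq> 0" if "n \<le> m" "h [n, x] \<noteq> 0" for x n m
      using stages_mono[OF h _ _ that(1), of "[x]" "h [n, x] - 1"] that(2) by simp
    show "x \<in> W \<longleftrightarrow> (\<exists>n. h [n, x] \<noteq> 0)" for x
    proof -
      have "x \<in> W \<longleftrightarrow> (\<exists>v n. h [n, x] = Suc v)"
        unfolding p using stages_iff[OF h, of "[x]"] by auto
      then show ?thesis by (metis not0_implies_Suc nat.distinct(1))
    qed
  qed
qed

section \<open>Joins, finite sets and change of oracle\<close>

lemma mem_set_join_iff:
  "x \<in> set_join A B \<longleftrightarrow> (x mod 2 = 0 \<and> x div 2 \<in> A) \<or> (x mod 2 = 1 \<and> x div 2 \<in> B)"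
proof (cases "even x")
  case True
  then obtain n where "x = 2 * n" by blast
  then show ?thesis
    using charf_set_join_even[of A B n] by (simp add: charf_def split: if_splits)
next
  case False
  then obtain n where "x = Suc (2 * n)" by (auto elim: oddE)
  then show ?thesis
    using charf_set_join_odd[of A B n] by (simp add: charf_def split: if_splits)
qed

lemma set_join_mono: "A \<subseteq> A' \<Longrightarrow> B \<subseteq> B' \<Longrightarrow> set_join A B \<subseteq> set_join A' B'"
  unfolding set_join_def by blast

lemma ce_in_set_join:
  assumes "ce_in A W1" and "ce_in A W2"
  shows "ce_in A (set_join W1 W2)"
proof -
  obtain h1 where h1: "recursive_in A 2 h1" "\<And>x. x \<in> W1 \<longleftrightarrow> (\<exists>n. h1 [n, x] \<noteq> 0)"
    using ce_in_stages[OF assms(1)] by metis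
  obtain h2 where h2: "recursive_in A 2 h2" "\<And>x. x \<in> W2 \<longleftrightarrow> (\<exists>n. h2 [n, x] \<noteq> 0)"
    using ce_in_stages[OF assms(2)] by metis
  define P where "P n x \<longleftrightarrow> (x mod 2 = 0 \<and> h1 [n, x div 2] \<noteq> 0) \<or> (x mod 2 = 1 \<and> h2 [n, x div 2] \<noteq> 0)"
    for n x :: nat
  have "recursive_in A (Suc (Suc 0)) (\<lambda>ys. of_bool (P (hd ys) (hd (tl ys))))"
    unfolding P_def
    by (intro recursive_in_disj recursive_in_conj recursive_in_not recursive_in_eq
        recursive_in_parity recursive_in_half recursive_in_const
        recursive_in_comp[OF h1(1)[unfolded numeral_2_eq_2]]
        recursive_in_comp[OF h2(1)[unfolded numeral_2_eq_2]]
        recursive_map_Cons recursive_map_Nil recursive_in_hd recursive_map_tl)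
      (rule recursive_map_id)+
  then have "ce_in A {x. \<exists>n. P n x}" by (intro ce_in_Ex) (simp add: numeral_2_eq_2)
  moreover have "{x. \<exists>n. P n x} = set_join W1 W2"
    unfolding P_def
    by (rule set_eqI) (simp only: mem_Collect_eq mem_set_join_iff h1(2) h2(2) ex_disj_distrib ex_simps)
  ultimately show ?thesis by simp
qed

lemma computable_in_empty: "computable_in A {}"
  unfolding computable_in_def by (rule exI[of _ Zero]) (simp add: charf_def)

text \<open>This supplies the finite table of exceptions in the case of finitely many
  errors.\<close>

lemma computable_in_finite:
  assumes "finite B"
  shows "computable_in A B"
  using assms
proof induction
  case empty
  show ?case by (rule computable_in_empty)
next
  case (insert b B)
  have "recursive_in A 1 (\<lambda>xs. of_bool (xs ! 0 = b \<or> xs ! 0 \<in> B))"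
    by (intro recursive_in_disj recursive_in_eq recursive_in_mem insert.IH recursive_in_const
        recursive_in_proj) simp_all
  then show ?case
    unfolding computable_in_iff_recursive_in by (rule recursive_in_cong) (simp add: charf_def)
qed

lemma recursive_in_computable2:
  assumes "computable2 g" and "recursive_in A k f1" and "recursive_in A k f2"
  shows "recursive_in A k (\<lambda>xs. g (f1 xs) (f2 xs))"
proof -
  obtain p where p: "\<And>x y. run {} p [x, y] = Some (g x y)"
    using assms(1) unfolding computable2_def by blast
  obtain r where "\<And>x. run A r [x] = Some (charf {} x)"
    using computable_in_empty unfolding computable_in_def by blast
  from run_subst_oracle[OF this] have "run A (subst_oracle r p) [x, y] = Some (g x y)" for x y
    by (simp add: p)
  from recursive_in_apply2[OF this assms(2,3)] show ?thesis .
qed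


section \<open>The interval\<close>

text \<open>The distance from \<open>c\<close> down to the nearest square. Between the squares of
  \<open>r\<close> and \<open>r + 1\<close> it runs through \<open>0\<close> to
  \<open>2 * r\<close>, so together with the root it gives an elementary coding of pairs.\<close>

definition excess :: "nat \<Rightarrow> nat" where
  "excess c = c - floor_sqrt c * floor_sqrt c"

lemma ex_pair_code:
  assumes "x \<le> 2 * r"
  shows "\<exists>c. excess c = x \<and> floor_sqrt c = r"
proof -
  have "floor_sqrt (r * r + x) = r"
    using assms by (intro floor_sqrt_unique) (simp_all add: power2_eq_square)
  then show ?thesis by (intro exI[of _ "r * r + x"]) (simp add: excess_def)
qed

lemma ex_excess_ge: "\<exists>c\<ge>n. excess c = x"
proof -
  \<comment> \<open>The root \<open>n + x\<close> is large enough both to admit the excess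
    \<open>x\<close> and to force \<open>n \<le> c\<close>.\<close>
  obtain c where "excess c = x" "floor_sqrt c = n + x"
    using ex_pair_code[of x "n + x"] by auto
  then show ?thesis using floor_sqrt_le[of c] by (intro exI[of _ c]) auto
qed

lemma recursive_in_excess:
  "recursive_in A k f \<Longrightarrow> recursive_in A k (\<lambda>xs. excess (f xs))"
  unfolding excess_def by (intro recursive_in_diff recursive_in_mult recursive_in_floor_sqrt)

text \<open>The bounds \<open>z < x < r\<close> are those under which a change at \<open>z\<close>
  makes the value \<open>Fs r x\<close> final, so frozen numbers with value \<open>1\<close> belong
  to \<open>F\<close>.\<close>

definition frozen :: "(nat \<Rightarrow> nat \<Rightarrow> nat) \<Rightarrow> nat set" where
  "frozen Fs = {x. \<exists>z r. z < x \<and> x < r \<and> Fs r z \<noteq> Fs (Suc r) z \<and> Fs r x = 1}"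

definition lower :: "(nat \<Rightarrow> nat \<Rightarrow> nat) \<Rightarrow> nat set" where
  "lower Fs = {c. excess c \<in> frozen Fs}"

definition upper :: "(nat \<Rightarrow> nat \<Rightarrow> nat) \<Rightarrow> nat set" where
  "upper Fs = {c. \<exists>t\<ge>c. Fs t (excess c) = 1}"

section \<open>Consequences of the nesting condition\<close>

locale nested_approx =
  fixes Fs :: "nat \<Rightarrow> nat \<Rightarrow> nat" and F :: "nat set"
  assumes approx: "Delta2_approx Fs F"
    and nested: "\<And>x y s t. x < y \<Longrightarrow> y < s \<Longrightarrow> s < t \<Longrightarrow> Fs s x \<noteq> Fs (Suc s) x \<Longrightarrow> Fs s y = Fs t y"
begin

lemma eventually_Fs: "\<forall>\<^sub>F s in sequentially. Fs s x = charf F x"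
  using approx unfolding Delta2_approx_def by (simp add: tendsto_discrete)

lemma charf_eqI:
  assumes "\<And>t. s < t \<Longrightarrow> Fs t x = v"
  shows "charf F x = v"
proof -
  have "\<forall>\<^sub>F t in sequentially. charf F x = v"
    using eventually_Fs[of x] eventually_gt_at_top[of s] by eventually_elim (simp add: assms)
  then show ?thesis by simp
qed

lemma recursive_in_Fs:
  assumes "recursive_in A k f1" and "recursive_in A k f2"
  shows "recursive_in A k (\<lambda>xs. Fs (f1 xs) (f2 xs))"
  using approx recursive_in_computable2[of "\<lambda>x s. Fs s x" A k f2 f1] assms
  unfolding Delta2_approx_def by blast

lemma charf_frozen:
  assumes "z < x" and "x < r" and "Fs r z \<noteq> Fs (Suc r) z"
  shows "charf F x = Fs r x"
  by (rule charf_eqI[of r]) (rule nested[OF assms(1,2) _ assms(3), symmetric])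

lemma frozen_subset: "frozen Fs \<subseteq> F"
  using charf_frozen unfolding frozen_def by (fastforce simp: charf_def split: if_splits)

text \<open>A change at \<open>z\<close> in passing from a stage \<open>r > x\<close> to the next
  would make \<open>Fs r x\<close> final, hence equal to \<open>1\<close> because
  \<open>x \<in> F\<close>, and so would put \<open>x\<close> into \<open>frozen Fs\<close>. Thus
  \<open>z\<close> is settled from the first such stage, \<open>Suc x\<close>, on.\<close>

lemma charf_eq_if_not_frozen:
  assumes "x \<in> F" and "x \<notin> frozen Fs" and "z < x"
  shows "charf F z = Fs (Suc x) z"
proof (rule charf_eqI)
  have step: "Fs (Suc r) z = Fs r z" if "x < r" for r
  proof (rule ccontr)
    assume "Fs (Suc r) z \<noteq> Fs r z"
    note change = this[symmetric]
    have "Fs r x = 1"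
      using charf_frozen[OF assms(3) that change] assms(1) by (simp add: charf_def)
    with change have "x \<in> frozen Fs" unfolding frozen_def using assms(3) that by blast
    with assms(2) show False by blast
  qed
  show "Fs t z = Fs (Suc x) z" if "x < t" for t
  proof -
    from that have "Suc x \<le> t" by simp
    then show ?thesis by (induction rule: dec_induct) (simp_all add: step)
  qed
qed

lemma upperI:
  assumes "excess c \<in> F"
  shows "c \<in> upper Fs"
  using eventually_conj[OF eventually_Fs[of "excess c"] eventually_ge_at_top[of c]] assms
  unfolding upper_def charf_def eventually_sequentially by auto

text \<open>A code of \<open>x\<close> beyond the stage at which the approximation settles on
  \<open>0\<close> never sees the value \<open>1\<close> again. This is why every number needs
  arbitrarily large codes.\<close>

lemma ex_not_upper:
  assumes "x \<notin> F"
  shows "\<exists>c. excess c = x \<and> c \<notin> upper Fs"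
proof -
  obtain n where n: "\<And>t. n \<le> t \<Longrightarrow> Fs t x = 0"
    using eventually_Fs[of x] assms unfolding eventually_sequentially charf_def by auto
  obtain c where "n \<le> c" "excess c = x" using ex_excess_ge by blast
  then show ?thesis using n unfolding upper_def by (intro exI[of _ c]) fastforce
qed

lemma lower_subset: "lower Fs \<subseteq> {c. excess c \<in> F}"
  using frozen_subset unfolding lower_def by blast

lemma subset_upper: "{c. excess c \<in> F} \<subseteq> upper Fs"
  using upperI by blast

section \<open>Both ends are c.e\<close>

lemma ce_upper: "ce (upper Fs)"
proof -
  have "recursive_in {} 2 (\<lambda>ys. of_bool (Fs (hd (tl ys) + hd ys) (excess (hd (tl ys))) = 1))"
    unfolding numeral_2_eq_2
    by (intro recursive_in_eq recursive_in_Fs recursive_in_add recursive_in_excess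
        recursive_in_const recursive_in_hd recursive_map_tl) (rule recursive_map_id)+
  from ce_in_Ex[OF this] have "ce_in {} {c. \<exists>n. Fs (c + n) (excess c) = 1}" .
  moreover have "{c. \<exists>n. Fs (c + n) (excess c) = 1} = upper Fs"
    unfolding upper_def by (auto simp: le_iff_add)
  ultimately show ?thesis unfolding ce_def by simp
qed

lemma ce_lower: "ce (lower Fs)"
proof -
  \<comment> \<open>The witness \<open>n\<close> codes the pair of \<open>z = excess n\<close> and
    \<open>r = floor_sqrt n\<close>. No pair is lost, since \<open>z < x < r\<close> implies
    \<open>z \<le> 2 * r\<close>.\<close>
  define P where "P n c \<longleftrightarrow> excess n < excess c \<and> excess c < floor_sqrt n \<and>
    \<not> Fs (floor_sqrt n) (excess n) = Fs (Suc (floor_sqrt n)) (excess n) \<and>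
    Fs (floor_sqrt n) (excess c) = 1" for n c
  have "recursive_in {} 2 (\<lambda>ys. of_bool (P (hd ys) (hd (tl ys))))"
    unfolding P_def numeral_2_eq_2
    by (intro recursive_in_conj recursive_in_less recursive_in_not recursive_in_eq recursive_in_Fs
        recursive_in_Suc recursive_in_excess recursive_in_floor_sqrt recursive_in_const
        recursive_in_hd recursive_map_tl) (rule recursive_map_id)+
  from ce_in_Ex[OF this] have "ce_in {} {c. \<exists>n. P n c}" .
  moreover have "(\<exists>n. P n c) \<longleftrightarrow> c \<in> lower Fs" for c
  proof
    assume "c \<in> lower Fs"
    then obtain z r where zr: "z < excess c" "excess c < r" "Fs r z \<noteq> Fs (Suc r) z"
      "Fs r (excess c) = 1" unfolding lower_def frozen_def by blast
    obtain n where "excess n = z" "floor_sqrt n = r"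
      using ex_pair_code[of z r] zr(1,2) by auto
    with zr have "P n c" unfolding P_def by simp
    then show "\<exists>n. P n c" ..
  qed (auto simp: P_def lower_def frozen_def)
  ultimately show ?thesis unfolding ce_def by simp
qed

section \<open>Computing \<open>F\<close> from a set in between\<close>

lemma computable_in_of_interval:
  assumes F: "ce_in A F" and A: "computable_in C A"
    and Y: "computable_in C Y" "lower Fs \<subseteq> Y" "Y \<subseteq> upper Fs"
  shows "computable_in C F"
proof -
  obtain h where hA: "recursive_in A 2 h"
    and h_mono: "\<And>x n m. n \<le> m \<Longrightarrow> h [n, x] \<noteq> 0 \<Longrightarrow> h [m, x] \<noteq> 0"
    and h_iff: "\<And>x. x \<in> F \<longleftrightarrow> (\<exists>n. h [n, x] \<noteq> 0)"
    using ce_in_stages[OF F] by metis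
  have h: "recursive_in C (Suc (Suc 0)) h"
    using recursive_in_mono[OF hA A] by (simp add: numeral_2_eq_2)
  \<comment> \<open>The errors of \<open>Y\<close>. The case distinction on their number selects one
    of two algorithms.\<close>
  define B where "B = {x \<in> F. \<exists>c. excess c = x \<and> c \<notin> Y}"
  show ?thesis
  proof (cases "finite B")
    case False
    \<comment> \<open>One number carries the whole search: \<open>excess w\<close> is a code missing
      from \<open>Y\<close>, its excess is the number \<open>x\<close> coded, and \<open>w\<close>
      itself is the stage by which \<open>x\<close> has entered \<open>F\<close>. As
      \<open>w\<close> can be arbitrarily large for a given code, every error is found.\<close>
    define P where "P w xs \<longleftrightarrow> \<not> excess w \<in> Y \<and> hd xs < excess (excess w) \<and>
      \<not> h [w, excess (excess w)] = 0" for w xs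
    have P_ex: "\<exists>w. P w xs" for xs
    proof -
      obtain x where "hd xs < x" "x \<in> B" 
        using False unfolding finite_nat_set_iff_bounded_le by (meson not_le)
      moreover from this obtain c where "excess c = x" "c \<notin> Y" unfolding B_def by blast
      moreover obtain n where "h [n, x] \<noteq> 0" using \<open>x \<in> B\<close> h_iff unfolding B_def by blast
      moreover obtain w where "n \<le> w" "excess w = c" using ex_excess_ge by blast
      ultimately have "P w xs" using h_mono unfolding P_def by blast
      then show ?thesis ..
    qed
    \<comment> \<open>The code found is missing from \<open>Y\<close>, hence from
      \<open>lower Fs\<close>, so its number is not frozen; every outcome of the search is therefore
      reliable.\<close>
    have P_charf: "charf F (hd xs) = Fs (Suc (excess (excess w))) (hd xs)" if "P w xs" for w xs
    proof (rule charf_eq_if_not_frozen)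
      show "excess (excess w) \<in> F" using that h_iff unfolding P_def by blast
      show "excess (excess w) \<notin> frozen Fs" using that Y(2) unfolding P_def lower_def by blast
      show "hd xs < excess (excess w)" using that unfolding P_def by blast
    qed
    have "recursive_in C (Suc (Suc 0)) (\<lambda>ys. of_bool (P (hd ys) (tl ys)))"
      unfolding P_def
      by (intro recursive_in_conj recursive_in_not recursive_in_mem[OF Y(1)] recursive_in_less
          recursive_in_eq recursive_in_excess recursive_in_const recursive_in_comp[OF h]
          recursive_map_Cons recursive_map_Nil recursive_in_hd recursive_map_tl)
        (rule recursive_map_id)+
    then have "recursive_in C 1 (\<lambda>xs. LEAST w. P w xs)"
      using P_ex by (intro recursive_in_Least) simp_all
    then have "recursive_in C (Suc 0)
        (\<lambda>xs. Fs (Suc (excess (excess (LEAST w. P w xs)))) (hd xs))"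
      by (intro recursive_in_Fs recursive_in_Suc recursive_in_excess recursive_in_hd)
        (simp | rule recursive_map_id)+
    moreover have "Fs (Suc (excess (excess (LEAST w. P w xs)))) (hd xs) = charf F (hd xs)" for xs
      by (rule P_charf[symmetric], rule LeastI_ex, rule P_ex)
    ultimately have "recursive_in C 1 (\<lambda>xs. charf F (hd xs))" by simp
    then show ?thesis
      unfolding computable_in_iff_recursive_in
      by (rule recursive_in_cong) (metis hd_conv_nth list.size(3) zero_neq_one)
  next
    case True
    \<comment> \<open>Here \<open>w\<close> has two roles: a stage that confirms membership in
      \<open>F\<close>, or a code of the input outside \<open>Y\<close>.\<close>
    define P where "P w xs \<longleftrightarrow> \<not> h [w, hd xs] = 0 \<or> (excess w = hd xs \<and> \<not> w \<in> Y)" for w xs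
    have P_ex: "\<exists>w. P w xs" for xs
    proof (cases "hd xs \<in> F")
      case True
      then show ?thesis using h_iff unfolding P_def by blast
    next
      case False
      then show ?thesis using ex_not_upper Y(3) unfolding P_def by blast
    qed
    \<comment> \<open>If the search stops only because of a code outside \<open>Y\<close>, the input
      can belong to \<open>F\<close> only as an error, and the finite set \<open>B\<close> decides
      that.\<close>
    have P_iff: "hd xs \<in> F \<longleftrightarrow> hd xs \<in> B \<or> \<not> h [w, hd xs] = 0" if "P w xs" for w xs
      using that h_iff unfolding P_def B_def by blast
    have "recursive_in C (Suc (Suc 0)) (\<lambda>ys. of_bool (P (hd ys) (tl ys)))"
      unfolding P_def
      by (intro recursive_in_disj recursive_in_conj recursive_in_not recursive_in_mem[OF Y(1)]
          recursive_in_eq recursive_in_excess recursive_in_const recursive_in_comp[OF h]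
          recursive_map_Cons recursive_map_Nil recursive_in_hd recursive_map_tl)
        (rule recursive_map_id)+
    then have "recursive_in C (Suc 0) (\<lambda>xs. LEAST w. P w xs)"
      using P_ex by (intro recursive_in_Least) simp_all
    then have "recursive_in C (Suc 0)
        (\<lambda>xs. of_bool (hd xs \<in> B \<or> \<not> h [LEAST w. P w xs, hd xs] = 0))"
      by (intro recursive_in_disj recursive_in_not recursive_in_eq recursive_in_const
          recursive_in_mem[OF computable_in_finite[OF True]] recursive_in_comp[OF h]
          recursive_map_Cons recursive_map_Nil recursive_in_hd)
        (assumption | rule recursive_map_id)+
    moreover have "(hd xs \<in> B \<or> \<not> h [LEAST w. P w xs, hd xs] = 0) \<longleftrightarrow> hd xs \<in> F" for xs
      by (rule P_iff[symmetric], rule LeastI_ex, rule P_ex)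
    ultimately have "recursive_in C 1 (\<lambda>xs. of_bool (hd xs \<in> F))" by (simp only: One_nat_def)
    then show ?thesis
      unfolding computable_in_iff_recursive_in
      by (rule recursive_in_cong) (metis charf_def hd_conv_nth list.size(3) of_bool_def zero_neq_one)
  qed
qed

end

section \<open>From sets to degrees\<close>

lemma degree_computable_iff: "degree_computable (degree_of C) X \<longleftrightarrow> computable_in C X"
  unfolding degree_computable_def
  by (metis computable_in_trans tdegree.abs_eq_iff turing_equiv_def)

theorem theorem4:
  fixes e f :: tdegree and F :: "nat set" and Fs :: "nat \<Rightarrow> nat \<Rightarrow> nat"
  assumes "ce_degree e"
    and "degree_of F = f"
    and "degree_ce e F"
    and "Delta2_approx Fs F"
    and "\<And>x y s t. x < y \<Longrightarrow> y < s \<Longrightarrow> s < t \<Longrightarrow> Fs s x \<noteq> Fs (Suc s) x \<Longrightarrow> Fs s y = Fs t y"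
  shows "\<exists>U V. ce U \<and> ce V \<and> U \<subseteq> V \<and>
    (\<forall>x. (\<exists>X. degree_computable x X \<and> U \<subseteq> X \<and> X \<subseteq> V) \<longleftrightarrow> sup e f \<le> x)"
proof -
  interpret nested_approx Fs F using assms(4,5) by unfold_locales
  obtain E where E: "ce E" "degree_of E = e" using assms(1) unfolding ce_degree_def by blast
  obtain A where A: "degree_of A = e" "ce_in A F" using assms(3) unfolding degree_ce_def by blast
  \<comment> \<open>The c.e. set \<open>E\<close> and the oracle \<open>A\<close> that enumerates
    \<open>F\<close> may be different members of the degree \<open>e\<close>.\<close>
  have EA: "computable_in E A"
    using A(1) E(2) tdegree.abs_eq_iff unfolding turing_equiv_def by metis
  let ?U = "set_join E (lower Fs)" and ?V = "set_join E (upper Fs)"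
  \<comment> \<open>The equivalence is proved for oracle sets first; every degree then has a
    representative \<open>C\<close>.\<close>
  have main: "(\<exists>X. computable_in C X \<and> ?U \<subseteq> X \<and> X \<subseteq> ?V) \<longleftrightarrow> computable_in C (set_join E F)" for C
  proof
    assume "\<exists>X. computable_in C X \<and> ?U \<subseteq> X \<and> X \<subseteq> ?V"
    then obtain X where X: "computable_in C X" "?U \<subseteq> X" "X \<subseteq> ?V" by blast
    \<comment> \<open>The even halves of \<open>?U\<close> and \<open>?V\<close> are both
      \<open>E\<close>, so that of \<open>X\<close> is exactly \<open>E\<close>; the odd half of
      \<open>X\<close> is the set between \<open>lower Fs\<close> and
      \<open>upper Fs\<close>.\<close>
    define Y where "Y = {c. Suc (2 * c) \<in> X}"
    have "2 * n \<in> X \<longleftrightarrow> n \<in> E" for n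
      using X(2,3) by (auto simp: subset_iff mem_set_join_iff)
    then have "charf E n = charf X (2 * n)" for n by (simp add: charf_def)
    then have "recursive_in C 1 (\<lambda>xs. charf E (xs ! 0))"
      by (simp only:) (intro recursive_in_charf X(1) recursive_in_mult recursive_in_const
          recursive_in_proj, simp)
    then have CE: "computable_in C E" by (simp only: computable_in_iff_recursive_in)
    have "charf Y n = charf X (Suc (2 * n))" for n by (simp add: charf_def Y_def)
    then have "recursive_in C 1 (\<lambda>xs. charf Y (xs ! 0))"
      by (simp only:) (intro recursive_in_charf X(1) recursive_in_mult recursive_in_const
          recursive_in_Suc recursive_in_proj, simp)
    then have "computable_in C Y" by (simp only: computable_in_iff_recursive_in)
    moreover have "lower Fs \<subseteq> Y" "Y \<subseteq> upper Fs"
      using X(2,3) unfolding Y_def by (auto simp: subset_iff mem_set_join_iff)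
    ultimately have "computable_in C F"
      by (intro computable_in_of_interval[OF A(2) computable_in_trans[OF CE EA]])
    with CE show "computable_in C (set_join E F)" by (rule computable_in_join_least)
  next
    assume C: "computable_in C (set_join E F)"
    let ?M = "{c. excess c \<in> F}"
    have "recursive_in C 1 (\<lambda>xs. charf F (excess (xs ! 0)))"
      by (intro recursive_in_charf computable_in_trans[OF C computable_in_join2]
          recursive_in_excess recursive_in_proj) simp
    then have "computable_in C ?M"
      unfolding computable_in_iff_recursive_in by (simp add: charf_def)
    then have "computable_in C (set_join E ?M)"
      by (intro computable_in_join_least computable_in_trans[OF C computable_in_join1])
    moreover have "?U \<subseteq> set_join E ?M" "set_join E ?M \<subseteq> ?V"
      by (intro set_join_mono order_refl lower_subset subset_upper)+
    ultimately show "\<exists>X. computable_in C X \<and> ?U \<subseteq> X \<and> X \<subseteq> ?V" by blast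
  qed
  have "(\<exists>X. degree_computable x X \<and> ?U \<subseteq> X \<and> X \<subseteq> ?V) \<longleftrightarrow> sup e f \<le> x" for x
  proof (induction x rule: tdegree.abs_induct)
    case (1 C)
    show ?case
      unfolding degree_computable_iff main E(2)[symmetric] assms(2)[symmetric]
        sup_tdegree.abs_eq less_eq_tdegree.abs_eq ..
  qed
  moreover have "ce ?U" "ce ?V"
    using E(1) ce_lower ce_upper unfolding ce_def by (auto intro: ce_in_set_join)
  moreover have "?U \<subseteq> ?V"
    by (intro set_join_mono order_refl subset_trans[OF lower_subset subset_upper])
  ultimately show ?thesis by blast
qed

end
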